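(* Let $n\geq 6$ be an integer with $n\not\equiv 1 \pmod 4$. Then $C_n^2$, the square of the cycle of order $n$, is irreducible, with $\tau\left(C_n^2\right)=3$.
   Context: Graphs are finite, simple and undirected; $d_G(x,y)$ is the distance between $x$ and $y$ in $G$. A vertex $w$ resolves a pair of vertices $u,v$ if $d_G(u,w)\neq d_G(v,w)$. A set $W\subseteq V(G)$ is a resolving set for $G$ if every pair of distinct vertices of $G$ is resolved by some vertex of $W$. The metric dimension $\beta(G)$ is the minimum cardinality of a resolving set for $G$ (with $\beta(K_1)=0$). The threshold dimension is $\tau(G)=\min\{\beta(H): H \text{ contains } G \text{ as a spanning subgraph}\}$, i.e. the minimum metric dimension among all graphs $H$ with $V(H)=V(G)$ and $E(G)\subseteq E(H)$. A graph $G$ is irreducible if $\tau(G)=\beta(G)$. The square $G^2$ of a graph $G$ is the graph with vertex set $V(G)$ in which two distinct vertices $u,v$ are adjacent if and only if $d_G(u,v)\leq 2$. $C_n$ is the cycle on $n$ vertices. *)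

theory Defs
  imports "Graph_Theory.Graph_Theory"
begin

text \<open>
  A finite simple undirected graph is a \<^locale>\<open>pair_graph\<close>: a finite, loop-free, symmetric
  digraph without parallel arcs, each edge \<open>uv\<close> being given by the two arcs \<open>(u, v)\<close> and \<open>(v, u)\<close>.
  The definitions below are meant for such graphs only.
\<close>

text \<open>The value is \<open>\<infinity>\<close> if \<open>u\<close> and \<open>v\<close> lie in different components.\<close>

definition graph_dist :: "'a pair_pre_digraph \<Rightarrow> 'a \<Rightarrow> 'a \<Rightarrow> ereal" where
  "graph_dist G u v = wf_digraph.\<mu> (with_proj G) (\<lambda>_. 1) u v"

definition resolves :: "'a pair_pre_digraph \<Rightarrow> 'a \<Rightarrow> 'a \<Rightarrow> 'a \<Rightarrow> bool" where
  "resolves G w u v \<longleftrightarrow> graph_dist G u w \<noteq> graph_dist G v w"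

definition resolving_set :: "'a pair_pre_digraph \<Rightarrow> 'a set \<Rightarrow> bool" where
  "resolving_set G W \<longleftrightarrow>
     W \<subseteq> pverts G \<and> (\<forall>u\<in>pverts G. \<forall>v\<in>pverts G. u \<noteq> v \<longrightarrow> (\<exists>w\<in>W. resolves G w u v))"

definition metric_dimension :: "'a pair_pre_digraph \<Rightarrow> nat" where
  "metric_dimension G = (LEAST k. \<exists>W. resolving_set G W \<and> card W = k)"

definition threshold_dimension :: "'a pair_pre_digraph \<Rightarrow> nat" where
  "threshold_dimension G =
     (LEAST k. \<exists>H. pair_graph H \<and> spanning (with_proj G) (with_proj H) \<and> metric_dimension H = k)"

definition irreducible_graph :: "'a pair_pre_digraph \<Rightarrow> bool" where
  "irreducible_graph G \<longleftrightarrow> threshold_dimension G = metric_dimension G"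

definition graph_square :: "'a pair_pre_digraph \<Rightarrow> 'a pair_pre_digraph" where
  "graph_square G =
     \<lparr> pverts = pverts G,
       parcs = {(u, v). u \<in> pverts G \<and> v \<in> pverts G \<and> u \<noteq> v \<and> graph_dist G u v \<le> 2} \<rparr>"

text \<open>The cycle on \<open>{0, \<dots>, n - 1}\<close>, for \<open>n \<ge> 3\<close>.\<close>

definition cycle_graph :: "nat \<Rightarrow> nat pair_pre_digraph" where
  "cycle_graph n =
     \<lparr> pverts = {..<n},
       parcs = {(u, v). u < n \<and> v < n \<and> (v = Suc u mod n \<or> u = Suc v mod n)} \<rparr>"

lemma pair_graph_cycle_graph:
  assumes "n \<ge> 3"
  shows "pair_graph (cycle_graph n)"
proof
  show "finite (parcs (cycle_graph n))"
    by (rule finite_subset[of _ "{..<n} \<times> {..<n}"]) (auto simp: cycle_graph_def)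
  show "fst e \<noteq> snd e" if "e \<in> parcs (cycle_graph n)" for e
    using that assms by (auto simp: cycle_graph_def mod_Suc split: if_splits)
qed (auto simp: cycle_graph_def symmetric_def intro: symI)

lemma (in pair_sym_digraph) awalk_reverse:
  assumes "awalk u p v"
  shows "\<exists>q. awalk v q u \<and> length q = length p"
  using assms
proof (induction p arbitrary: u)
  case Nil
  then show ?case by (auto simp: awalk_Nil_iff intro!: exI[of _ "[]"])
next
  case (Cons e p)
  then have e: "e \<in> parcs G" "u = fst e" and "awalk (snd e) p v"
    by (auto simp: awalk_Cons_iff)
  with Cons.IH obtain q where q: "awalk v q (snd e)" "length q = length p" by blast
  have "(snd e, fst e) \<in> parcs G"
    using e pair_sym_arcs by (cases e) (auto simp: symmetric_def dest: symD)
  then have "awalk (snd e) [(snd e, fst e)] (fst e)"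
    by (auto simp: awalk_Cons_iff awalk_Nil_iff in_arcsD2)
  with q e have "awalk v (q @ [(snd e, fst e)]) u"
    by (auto intro: awalk_appendI)
  with q(2) show ?case by (intro exI[of _ "q @ [(snd e, fst e)]"]) simp
qed

lemma (in pair_wf_digraph) graph_dist_conv:
  "graph_dist G u v = (INF p\<in>{p. awalk u p v}. ereal (real (length p)))"
proof -
  have "awalk_cost (\<lambda>_. 1) p = real (length p)" for p :: "('a \<times> 'a) awalk"
    by (induction p) auto
  then show ?thesis by (simp add: graph_dist_def \<mu>_def)
qed

lemma (in pair_sym_digraph) graph_dist_commute: "graph_dist G u v = graph_dist G v u"
proof -
  have "graph_dist G u v \<le> graph_dist G v u" for u v
    unfolding graph_dist_conv
  proof (rule INF_greatest)
    fix q assume "q \<in> {p. awalk v p u}"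
    then obtain p where "awalk u p v" "length p = length q" using awalk_reverse by blast
    then show "(INF p\<in>{p. awalk u p v}. ereal (real (length p))) \<le> ereal (real (length q))"
      by (intro INF_lower2[of p]) auto
  qed
  then show ?thesis by (simp add: antisym)
qed

lemma (in pair_graph) pair_graph_graph_square: "pair_graph (graph_square G)"
proof
  show "finite (parcs (graph_square G))"
    by (rule finite_subset[of _ "pverts G \<times> pverts G"]) (auto simp: graph_square_def)
qed (auto simp: graph_square_def symmetric_def graph_dist_commute intro!: symI)

end

theory Submission
  imports Defs
begin

text \<open>
  Let \<open>W\<close> be a resolving set and \<open>a \<in> W\<close>. The neighbours of \<open>a\<close> all have distance 1 from \<open>a\<close>, and
  their distance from any other \<open>w \<in> W\<close> is off by at most one from that of \<open>a\<close>; as they are told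
  apart by these distances, \<open>a\<close> has at most \<open>3 ^ (card W - 1)\<close> neighbours. Since all degrees in
  \<open>C\<^sub>n\<^sup>2\<close>, hence in every graph containing it, are at least 4, no resolving set has fewer than three
  elements. On the other hand, \<open>{0, 1, 2}\<close> resolves \<open>C\<^sub>n\<^sup>2\<close> for \<open>n mod 4 \<noteq> 1\<close>.
\<close>

section \<open>Distances\<close>

context pair_wf_digraph
begin

lemma graph_dist_le_length:
  assumes "awalk u p v"
  shows "graph_dist G u v \<le> ereal (real (length p))"
  unfolding graph_dist_conv using assms by (intro INF_lower2[of p]) auto

text \<open>Walk lengths are natural numbers, so the infimum is attained as soon as some walk
  exists; over no walks it is infinite. Case analysis on this replaces reasoning about infima in
  \<open>ereal\<close>.\<close>

lemma graph_dist_cases: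
  obtains (infinite) "graph_dist G u v = \<infinity>" "\<nexists>p. awalk u p v"
    | (finite) p where "awalk u p v" "graph_dist G u v = ereal (real (length p))"
proof (cases "\<exists>p. awalk u p v")
  case True
  then obtain p where p: "awalk u p v" "\<And>q. awalk u q v \<Longrightarrow> length p \<le> length q"
    using ex_has_least_nat[of "\<lambda>p. awalk u p v" _ length] by blast
  then have "graph_dist G u v \<ge> ereal (real (length p))"
    unfolding graph_dist_conv by (intro INF_greatest) auto
  with p(1) show thesis using graph_dist_le_length finite by (metis antisym)
next
  case False
  then show thesis by (intro infinite) (auto simp: graph_dist_conv top_ereal_def)
qed

lemma graph_dist_self: "u \<in> pverts G \<Longrightarrow> graph_dist G u u = 0"
  by (rule antisym, use graph_dist_le_length[of u "[]" u] in \<open>simp add: awalk_Nil_iff zero_ereal_def\<close>)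
     (auto simp: graph_dist_conv intro: INF_greatest)

lemma graph_dist_ge_1:
  assumes "u \<noteq> v"
  shows "graph_dist G u v \<ge> 1"
proof (cases u v rule: graph_dist_cases)
  case (finite p)
  with assms show ?thesis by (cases p) (auto simp: awalk_Nil_iff)
qed simp

lemma graph_dist_arc_le:
  assumes "(u, v) \<in> parcs G"
  shows "graph_dist G u w \<le> graph_dist G v w + 1"
proof (cases v w rule: graph_dist_cases)
  case (finite p)
  then have "awalk u ((u, v) # p) w"
    using assms by (auto simp: awalk_Cons_iff)
  from graph_dist_le_length[OF this] finite show ?thesis by (simp add: add.commute)
qed simp

text \<open>A certificate for a guessed distance formula: following \<open>descent\<close> from
  \<open>u\<close> builds a walk of length \<open>f u\<close> to \<open>w\<close>, while
  \<open>lipschitz\<close> lets \<open>f\<close> drop by at most 1 per arc, so no walk is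
  shorter.\<close>

lemma graph_dist_eqI:
  fixes f :: "'a \<Rightarrow> nat"
  assumes "f w = 0" and "w \<in> pverts G"
    and lipschitz: "\<And>u v. (u, v) \<in> parcs G \<Longrightarrow> f u \<le> Suc (f v)"
    and descent: "\<And>u. u \<in> pverts G \<Longrightarrow> u \<noteq> w \<Longrightarrow> \<exists>v. (u, v) \<in> parcs G \<and> f u = Suc (f v)"
    and "u \<in> pverts G"
  shows "graph_dist G u w = ereal (real (f u))"
proof (rule antisym)
  have "\<exists>p. awalk u p w \<and> length p = f u"
    using \<open>u \<in> pverts G\<close>
  proof (induction "f u" arbitrary: u)
    case 0
    then have "u = w" using descent[of u] by force
    with 0 show ?case by (intro exI[of _ "[]"]) (auto simp: awalk_Nil_iff)
  next
    case (Suc k)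
    then have "u \<noteq> w" using \<open>f w = 0\<close> by auto
    with Suc.prems obtain v where v: "(u, v) \<in> parcs G" "f u = Suc (f v)" using descent by blast
    then have "v \<in> pverts G" by (auto dest: in_arcsD2)
    with Suc.hyps v obtain p where "awalk v p w" "length p = f v" by (metis Suc_inject)
    with v show ?case by (intro exI[of _ "(u, v) # p"]) (auto simp: awalk_Cons_iff)
  qed
  then show "graph_dist G u w \<le> ereal (real (f u))" using graph_dist_le_length by metis
next
  have "f u \<le> length p" if "awalk u p w" for p
    using that
  proof (induction p arbitrary: u)
    case Nil
    then show ?case using \<open>f w = 0\<close> by (auto simp: awalk_Nil_iff)
  next
    case (Cons e p)
    then have "e \<in> parcs G" "u = fst e" "f (snd e) \<le> length p"
      by (auto simp: awalk_Cons_iff)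
    then show ?case using lipschitz[of u "snd e"] by simp
  qed
  then show "ereal (real (f u)) \<le> graph_dist G u w"
    unfolding graph_dist_conv by (intro INF_greatest) auto
qed

text \<open>Each vertex tells itself apart from all others, having distance 0 from itself only. This
  ensures that the minimum in \<open>metric_dimension\<close> is attained.\<close>

lemma resolving_set_pverts: "resolving_set G (pverts G)"
  unfolding resolving_set_def resolves_def
proof (intro conjI ballI impI bexI)
  fix u v assume "u \<in> pverts G" "v \<in> pverts G" "u \<noteq> v"
  then show "graph_dist G u u \<noteq> graph_dist G v u"
    using graph_dist_self[of u] graph_dist_ge_1[of v u] by auto
qed auto

lemma metric_dimension_witness:
  obtains W where "resolving_set G W" "card W = metric_dimension G"
  using LeastI_ex[of "\<lambda>k. \<exists>W. resolving_set G W \<and> card W = k"] resolving_set_pverts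
  unfolding metric_dimension_def by blast

end

section \<open>The lower bound\<close>

context pair_graph
begin

lemma graph_dist_neighbour:
  assumes "(a, x) \<in> parcs G"
  shows "graph_dist G x w \<in> {graph_dist G a w - 1, graph_dist G a w, graph_dist G a w + 1}"
proof -
  have "(x, a) \<in> parcs G"
    using assms pair_sym_arcs by (auto simp: symmetric_def dest: symD)
  then have le: "graph_dist G x w \<le> graph_dist G a w + 1" "graph_dist G a w \<le> graph_dist G x w + 1"
    using assms graph_dist_arc_le by auto
  show ?thesis
  proof (cases a w rule: graph_dist_cases)
    \<comment> \<open>Both distances are then infinite, and subtracting 1 from infinity leaves it
      unchanged, so no connectedness is required.\<close>
    case infinite
    with le show ?thesis by (cases "graph_dist G x w") auto
  next
    case a: (finite p)
    show ?thesis
    proof (cases x w rule: graph_dist_cases)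
      case infinite
      with a le show ?thesis by auto
    next
      case (finite q)
      with a le have "length q \<le> length p + 1" "length p \<le> length q + 1"
        by (auto simp: one_ereal_def)
      then consider "length p = Suc (length q)" | "length q = length p" | "length q = Suc (length p)"
        by linarith
      then show ?thesis using a finite by cases (auto simp: one_ereal_def)
    qed
  qed
qed

lemma degree_le_if_resolving_set:
  assumes W: "resolving_set G W" and "a \<in> W"
  shows "card {x. (a, x) \<in> parcs G} \<le> 3 ^ (card W - 1)"
proof -
  define N where "N = {x. (a, x) \<in> parcs G}"
  define D where "D w = {graph_dist G a w - 1, graph_dist G a w, graph_dist G a w + 1}" for w
  \<comment> \<open>The coordinate at \<open>a\<close> is dropped because it is 1 for every
    neighbour; this is where the exponent \<open>card W - 1\<close> comes from.\<close>
  define \<phi> where "\<phi> x = (\<lambda>w\<in>W - {a}. graph_dist G x w)" for x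
  have fin: "finite W" using W finite_subset[of W "pverts G"] by (auto simp: resolving_set_def)
  have N_verts: "x \<in> pverts G" if "x \<in> N" for x
    using that by (auto simp: N_def dest: in_arcsD2)
  have dist_a: "graph_dist G x a = 1" if "x \<in> N" for x
  proof -
    have ax: "(a, x) \<in> parcs G" using that by (simp add: N_def)
    then have "(x, a) \<in> parcs G"
      using pair_sym_arcs by (auto simp: symmetric_def dest: symD)
    moreover have "a \<in> pverts G" "x \<noteq> a" using ax pair_no_loops[of "(a, x)"] by (auto dest: in_arcsD1)
    ultimately have "graph_dist G x a \<le> 1" "graph_dist G x a \<ge> 1"
      using graph_dist_arc_le[of x a a] graph_dist_self[of a] graph_dist_ge_1[of x a] by simp_all
    then show ?thesis by (rule antisym)
  qed
  have "inj_on \<phi> N"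
  proof (rule inj_onI, rule ccontr)
    fix x y assume xy: "x \<in> N" "y \<in> N" "\<phi> x = \<phi> y" "x \<noteq> y"
    then obtain w where w: "w \<in> W" "graph_dist G x w \<noteq> graph_dist G y w"
      using W N_verts unfolding resolving_set_def resolves_def by metis
    then have "w \<noteq> a" using dist_a xy by auto
    with w xy(3) show False by (auto simp: \<phi>_def dest!: fun_cong[of _ _ w])
  qed
  moreover have "\<phi> ` N \<subseteq> Pi\<^sub>E (W - {a}) D"
    unfolding \<phi>_def D_def N_def by (intro image_subsetI restrict_PiE_iff[THEN iffD2] ballI)
      (use graph_dist_neighbour in blast)
  moreover have "finite (Pi\<^sub>E (W - {a}) D)" using fin by (auto simp: D_def intro: finite_PiE)
  ultimately have "card N \<le> card (Pi\<^sub>E (W - {a}) D)" by (rule card_inj_on_le)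
  also have "\<dots> = (\<Prod>w\<in>W - {a}. card (D w))" using fin by (simp add: card_PiE)
  \<comment> \<open>Only an inequality: the three values in \<open>D w\<close> coincide when the
    distance is infinite.\<close>
  also have "\<dots> \<le> (\<Prod>w\<in>W - {a}. 3)"
    by (intro prod_mono) (auto simp: D_def card_insert_if)
  also have "\<dots> = 3 ^ (card W - 1)" using fin \<open>a \<in> W\<close> by simp
  finally show ?thesis by (simp add: N_def)
qed

lemma metric_dimension_ge_3:
  assumes deg: "\<And>a. a \<in> pverts G \<Longrightarrow> card {x. (a, x) \<in> parcs G} \<ge> 4"
    and "pverts G \<noteq> {}"
  shows "metric_dimension G \<ge> 3"
proof -
  obtain W where W: "resolving_set G W" "card W = metric_dimension G"
    by (rule metric_dimension_witness)
  have "W \<noteq> {}"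
  proof
    assume "W = {}"
    obtain a where a: "a \<in> pverts G" using \<open>pverts G \<noteq> {}\<close> by blast
    then obtain x where "(a, x) \<in> parcs G" using deg[OF a] by fastforce
    then have "x \<in> pverts G" "x \<noteq> a" using pair_no_loops[of "(a, x)"] by (auto dest: in_arcsD2)
    with a W \<open>W = {}\<close> show False by (auto simp: resolving_set_def)
  qed
  then obtain a where "a \<in> W" by blast
  with W deg[of a] degree_le_if_resolving_set[of W a] have "(4::nat) \<le> 3 ^ (card W - 1)"
    by (auto simp: resolving_set_def)
  \<comment> \<open>An exponent of at most 1 would give at most 3 neighbours.\<close>
  then have "\<not> card W - 1 \<le> 1" using power_increasing[of "card W - 1" 1 "3::nat"] by auto
  then show ?thesis using W by simp
qed

end

section \<open>Squares of cycles\<close>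

definition cyc_dist :: "nat \<Rightarrow> nat \<Rightarrow> nat \<Rightarrow> nat" where
  "cyc_dist n u v = (let d = (if u \<le> v then v - u else u - v) in min d (n - d))"

lemma cyc_dist_commute: "cyc_dist n u v = cyc_dist n v u"
  by (simp add: cyc_dist_def)

lemma cyc_dist_near: "u \<le> v \<Longrightarrow> 2 * (v - u) \<le> n \<Longrightarrow> cyc_dist n u v = v - u"
  by (simp add: cyc_dist_def Let_def)

lemma cyc_dist_far: "u \<le> v \<Longrightarrow> v < n \<Longrightarrow> 2 * (v - u) \<ge> n \<Longrightarrow> cyc_dist n u v = n - v + u"
  by (simp add: cyc_dist_def Let_def)

text \<open>Free of minima and subtraction, hence usable by linear arithmetic. The last two
  disjuncts describe arcs that pass between \<open>n - 1\<close> and 0.\<close>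

lemma cyc_dist_le_iff:
  assumes "u < n" "v < n"
  shows "cyc_dist n u v \<le> k \<longleftrightarrow> u \<le> v + k \<and> v \<le> u + k \<or> u + n \<le> v + k \<or> v + n \<le> u + k"
  using assms by (cases "u \<le> v") (auto simp: cyc_dist_def Let_def min_le_iff_disj)

lemma cycle_graph_arc_iff:
  "(u, v) \<in> parcs (cycle_graph n) \<longleftrightarrow> u < n \<and> v < n \<and>
     (v = Suc u \<or> u = Suc v \<or> Suc u = n \<and> v = 0 \<or> Suc v = n \<and> u = 0)"
  by (auto simp: cycle_graph_def mod_Suc)

text \<open>Move one step along a shorter arc towards \<open>w\<close>: the four cases say on which
  side of \<open>u\<close> the number \<open>w\<close> lies and whether the direct arc or the one
  through 0 is taken.\<close>

lemma cyc_dist_descent: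
  assumes "u < n" "w < n" "u \<noteq> w"
  shows "\<exists>v. (u, v) \<in> parcs (cycle_graph n) \<and> cyc_dist n u w = Suc (cyc_dist n v w)"
proof -
  define up where "up = (if Suc u = n then 0 else Suc u)"
  define down where "down = (if u = 0 then n - 1 else u - 1)"
  have arcs: "(u, up) \<in> parcs (cycle_graph n)" "(u, down) \<in> parcs (cycle_graph n)"
    using assms by (auto simp: cycle_graph_arc_iff up_def down_def)
  consider "u < w" "2 * (w - u) \<le> n" | "u < w" "2 * (w - u) > n"
    | "w < u" "2 * (u - w) \<le> n" | "w < u" "2 * (u - w) > n"
    using \<open>u \<noteq> w\<close> by linarith
  then have "cyc_dist n u w = Suc (cyc_dist n up w) \<or> cyc_dist n u w = Suc (cyc_dist n down w)"
  proof cases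
    case 1
    then have "cyc_dist n up w = w - Suc u"
      using assms cyc_dist_near[of "Suc u" w n] by (auto simp: up_def)
    with 1 show ?thesis by (simp add: cyc_dist_near Suc_diff_Suc)
  next
    case 2
    have "cyc_dist n down w = n - w + u - 1"
    proof (cases "u = 0")
      case True
      with 2 assms cyc_dist_near[of w "n - 1" n] show ?thesis
        by (simp add: down_def cyc_dist_commute[of n "n - Suc 0"])
    next
      case False
      with 2 assms cyc_dist_far[of "u - 1" w n] show ?thesis by (simp add: down_def)
    qed
    with 2 assms show ?thesis by (simp add: cyc_dist_far Suc_diff_Suc)
  next
    case 3
    then have "cyc_dist n down w = u - 1 - w"
      using cyc_dist_near[of w "u - 1" n] by (simp add: down_def cyc_dist_commute[of n _ w])
    with 3 show ?thesis by (simp add: cyc_dist_near Suc_diff_Suc cyc_dist_commute[of n _ w])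
  next
    case 4
    have "cyc_dist n up w = n - Suc u + w"
    proof (cases "Suc u = n")
      case True
      with 4 assms cyc_dist_near[of 0 w n] show ?thesis by (simp add: up_def)
    next
      case False
      with 4 assms cyc_dist_far[of w "Suc u" n] show ?thesis
        by (simp add: up_def cyc_dist_commute[of n _ w])
    qed
    with 4 assms show ?thesis by (simp add: cyc_dist_far Suc_diff_Suc cyc_dist_commute[of n _ w])
  qed
  with arcs show ?thesis by blast
qed

lemma cyc_dist_triangle:
  assumes "u < n" "v < n" "w < n"
  shows "cyc_dist n u w \<le> cyc_dist n u v + cyc_dist n v w"
proof -
  \<comment> \<open>Taking the distances themselves as bounds turns both into linear constraints via
    \<open>cyc_dist_le_iff\<close>.\<close>
  define k l where "k = cyc_dist n u v" and "l = cyc_dist n v w"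
  have "u \<le> v + k \<and> v \<le> u + k \<or> u + n \<le> v + k \<or> v + n \<le> u + k"
    "v \<le> w + l \<and> w \<le> v + l \<or> v + n \<le> w + l \<or> w + n \<le> v + l"
    using assms by (simp_all add: k_def l_def flip: cyc_dist_le_iff)
  with assms have "u \<le> w + (k + l) \<and> w \<le> u + (k + l) \<or> u + n \<le> w + (k + l) \<or> w + n \<le> u + (k + l)"
    by linarith
  with assms show ?thesis by (simp add: cyc_dist_le_iff k_def l_def)
qed

lemma cyc_dist_arc:
  assumes "(u, v) \<in> parcs (cycle_graph n)"
  shows "cyc_dist n u v \<le> 1"
  using assms cyc_dist_le_iff[of u n v 1] by (auto simp: cycle_graph_arc_iff)

lemma cyc_dist_eq_0_iff:
  assumes "u < n" "v < n"
  shows "cyc_dist n u v = 0 \<longleftrightarrow> u = v"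
  using assms cyc_dist_le_iff[of u n v 0] by auto

lemma pverts_cycle_graph: "pverts (cycle_graph n) = {..<n}"
  by (simp add: cycle_graph_def)

lemma graph_dist_cycle_graph:
  assumes "n \<ge> 3" "u < n" "w < n"
  shows "graph_dist (cycle_graph n) u w = ereal (real (cyc_dist n u w))"
proof -
  interpret pair_graph "cycle_graph n" using assms by (intro pair_graph_cycle_graph)
  show ?thesis
  proof (rule graph_dist_eqI)
    show "cyc_dist n u w \<le> Suc (cyc_dist n v w)" if "(u, v) \<in> parcs (cycle_graph n)" for u v
    proof -
      have "u < n" "v < n" using that by (simp_all add: cycle_graph_arc_iff)
      with cyc_dist_triangle[of u n v w] cyc_dist_arc[OF that] assms show ?thesis by linarith
    qed
    show "\<exists>v. (u, v) \<in> parcs (cycle_graph n) \<and> cyc_dist n u w = Suc (cyc_dist n v w)"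
      if "u \<in> pverts (cycle_graph n)" "u \<noteq> w" for u
      using that assms by (intro cyc_dist_descent) (simp_all add: pverts_cycle_graph)
  qed (use assms in \<open>simp_all add: pverts_cycle_graph cyc_dist_eq_0_iff\<close>)
qed

section \<open>Distances and degrees in the square\<close>

lemma pverts_square_cycle: "pverts (graph_square (cycle_graph n)) = {..<n}"
  by (simp add: graph_square_def pverts_cycle_graph)

lemma square_cycle_arc_iff:
  assumes "n \<ge> 3"
  shows "(u, v) \<in> parcs (graph_square (cycle_graph n)) \<longleftrightarrow>
           u < n \<and> v < n \<and> u \<noteq> v \<and> cyc_dist n u v \<le> 2"
proof -
  have "ereal (real k) \<le> 2 \<longleftrightarrow> k \<le> 2" for k
    by simp
  then show ?thesis
    using assms by (auto simp: graph_square_def pverts_cycle_graph graph_dist_cycle_graph)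
qed

text \<open>An edge of the square covers at most two cycle steps, so the distance is half the cycle
  distance, rounded up. For the descent, two cycle steps towards \<open>w\<close> are merged into
  one edge; if the first step already reaches \<open>w\<close>, it is used alone.\<close>

lemma graph_dist_square_cycle:
  assumes "n \<ge> 3" "u < n" "w < n"
  shows "graph_dist (graph_square (cycle_graph n)) u w = ereal (real ((cyc_dist n u w + 1) div 2))"
proof -
  interpret C: pair_graph "cycle_graph n" using assms by (intro pair_graph_cycle_graph)
  interpret pair_graph "graph_square (cycle_graph n)" by (rule C.pair_graph_graph_square)
  show ?thesis
  proof (rule graph_dist_eqI)
    show "(cyc_dist n u w + 1) div 2 \<le> Suc ((cyc_dist n v w + 1) div 2)"
      if "(u, v) \<in> parcs (graph_square (cycle_graph n))" for u v
    proof -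
      have "u < n" "v < n" "cyc_dist n u v \<le> 2"
        using that assms by (simp_all add: square_cycle_arc_iff)
      with cyc_dist_triangle[of u n v w] assms have "cyc_dist n u w \<le> cyc_dist n v w + 2" by linarith
      then show ?thesis by linarith
    qed
  next
    fix u assume "u \<in> pverts (graph_square (cycle_graph n))" "u \<noteq> w"
    then have u: "u < n" "u \<noteq> w" by (auto simp: pverts_square_cycle)
    obtain v where v: "(u, v) \<in> parcs (cycle_graph n)" "cyc_dist n u w = Suc (cyc_dist n v w)"
      using cyc_dist_descent u assms by blast
    then have vn: "v < n" by (simp add: cycle_graph_arc_iff)
    show "\<exists>v. (u, v) \<in> parcs (graph_square (cycle_graph n)) \<and>
            (cyc_dist n u w + 1) div 2 = Suc ((cyc_dist n v w + 1) div 2)"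
    proof (cases "v = w")
      case True
      then have "cyc_dist n v w = 0" by (simp add: cyc_dist_def)
      then show ?thesis using v u vn cyc_dist_arc[OF v(1)] assms
        by (intro exI[of _ v]) (auto simp: square_cycle_arc_iff)
    next
      case False
      obtain x where x: "(v, x) \<in> parcs (cycle_graph n)" "cyc_dist n v w = Suc (cyc_dist n x w)"
        using cyc_dist_descent vn False assms by blast
      then have "x < n" by (simp add: cycle_graph_arc_iff)
      moreover have "cyc_dist n u x \<le> 2"
        using cyc_dist_triangle[of u n v x] u vn \<open>x < n\<close> cyc_dist_arc[OF v(1)] cyc_dist_arc[OF x(1)]
        by simp
      moreover have "u \<noteq> x" using v x by auto
      ultimately show ?thesis using u v x assms
        by (intro exI[of _ x]) (auto simp: square_cycle_arc_iff)
    qed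
  qed (use assms in \<open>simp_all add: pverts_square_cycle cyc_dist_eq_0_iff\<close>)
qed

lemma degree_square_cycle_ge_4:
  assumes "n \<ge> 6" "u < n"
  shows "\<exists>N. card N = 4 \<and> (\<forall>x\<in>N. (u, x) \<in> parcs (graph_square (cycle_graph n)))"
proof -
  \<comment> \<open>\<open>sh k\<close> is \<open>u + k\<close> modulo \<open>n\<close>; the shifts
    \<open>n - 1\<close> and \<open>n - 2\<close> are the steps back by 1 and 2.\<close>
  define sh where "sh k = (if u + k < n then u + k else u + k - n)" for k
  have "inj_on sh {1, 2, n - 1, n - 2}"
    using assms by (auto simp: inj_on_def sh_def split: if_splits)
  then have "card (sh ` {1, 2, n - 1, n - 2}) = card {1, 2, n - 1, n - 2}" by (rule card_image)
  also have "\<dots> = 4" using assms by (auto simp: card_insert_if)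
  finally have "card (sh ` {1, 2, n - 1, n - 2}) = 4" .
  moreover have "(u, x) \<in> parcs (graph_square (cycle_graph n))" if "x \<in> sh ` {1, 2, n - 1, n - 2}" for x
    using that assms
    by (auto simp: square_cycle_arc_iff sh_def cyc_dist_le_iff split: if_splits)
  ultimately show ?thesis by blast
qed

section \<open>Resolving the square by 0, 1 and 2\<close>

text \<open>
  Up to rounding, the shortest ways from \<open>u\<close> to 0, 1 and 2 go round the same side of the cycle, and
  then a sum of two of the distances recovers \<open>u\<close>, unless \<open>u\<close> is opposite to 1. For \<open>n = 4 * k + 1\<close>
  this fails: both \<open>2 * k + 1\<close> and \<open>2 * k + 2\<close> have distance \<open>k\<close> from 0, 1 and 2.
\<close>

lemma half_cyc_dist_cases:
  assumes "n mod 4 \<noteq> 1" "2 \<le> u" "u < n"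
    and h: "\<And>w. h w = (cyc_dist n u w + 1) div 2"
  shows "h 0 = h 2 + 1 \<and> h 0 + h 1 = u
       \<or> h 2 = h 0 + 1 \<and> h 1 + h 2 = n - u + 2
       \<or> h 0 = h 2 \<and> 2 * u = n + 2"
proof -
  have near_side: "cyc_dist n u w = u - w" if "w \<le> 2" "2 * (u - w) \<le> n" for w
    using that assms(2) by (simp add: cyc_dist_near cyc_dist_commute[of n u])
  have far_side: "cyc_dist n u w = n - u + w" if "w \<le> 2" "2 * (u - w) \<ge> n" for w
    using that assms(2,3) by (simp add: cyc_dist_far cyc_dist_commute[of n u])
  obtain a where a: "u = a + 2" using \<open>2 \<le> u\<close> le_iff_add by (metis add.commute)
  obtain b where b: "n = u + b" using \<open>u < n\<close> less_imp_add_positive by blast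
  \<comment> \<open>In the first two cases 0, 1 and 2 are all reached round the same side. Otherwise
    \<open>2 * u\<close> lies strictly between \<open>n\<close> and \<open>n + 4\<close>, so
    \<open>u\<close> is opposite to 1 or half a step away from that point.\<close>
  consider "2 * u \<le> n" | "2 * (u - 2) \<ge> n" | "2 * u = n + 2" | "2 * u = n + 1" | "2 * u = n + 3"
    by linarith
  then show ?thesis
  proof cases
    case 1
    then have "h 0 = (a + 3) div 2" "h 1 = (a + 2) div 2" "h 2 = (a + 1) div 2"
      using near_side[of 0] near_side[of 1] near_side[of 2] by (simp_all add: h a)
    then have "h 0 = h 2 + 1" "h 0 + h 1 = u" unfolding a by presburger+
    then show ?thesis by blast
  next
    case 2
    then have "h 0 = (b + 1) div 2" "h 1 = (b + 2) div 2" "h 2 = (b + 3) div 2"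
      using far_side[of 0] far_side[of 1] far_side[of 2] by (simp_all add: h b)
    then have "h 2 = h 0 + 1" "h 1 + h 2 = b + 2" by presburger+
    then show ?thesis by (simp add: b)
  next
    case 3
    then have "h 0 = (b + 1) div 2" "h 2 = (a + 1) div 2"
      using far_side[of 0] near_side[of 2] by (simp_all add: h a b)
    with 3 show ?thesis by (simp add: a b)
  next
    case 4
    \<comment> \<open>Now \<open>n\<close> is odd, so it is 3 modulo 4, which fixes the parity of
      \<open>u\<close>. The last case is its mirror image.\<close>
    with assms(1,2) have "\<exists>j. u = 2 * j + 2" by presburger
    then obtain j where j: "u = 2 * j + 2" by blast
    with 4 have "n = 4 * j + 3" by simp
    with j have "h 0 = j + 1" "h 1 = j + 1" "h 2 = j"
      using far_side[of 0] near_side[of 1] near_side[of 2] by (simp_all add: h)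
    with j show ?thesis by simp
  next
    case 5
    with assms(1,2) have "\<exists>j. u = 2 * j + 3" by presburger
    then obtain j where j: "u = 2 * j + 3" by blast
    with 5 have n: "n = 4 * j + 3" by simp
    with j have "h 0 = j" "h 1 = j + 1" "h 2 = j + 1"
      using far_side[of 0] far_side[of 1] near_side[of 2] by (simp_all add: h)
    with j n show ?thesis by simp
  qed
qed

text \<open>The vertices 0 and 1 are recognised by a zero distance. For the others, comparing the
  distances from 0 and 2 selects one alternative of \<open>half_cyc_dist_cases\<close>, and each
  alternative yields the vertex by a linear equation.\<close>

lemma half_cyc_dist_determines:
  assumes "n \<ge> 6" "n mod 4 \<noteq> 1" "u < n" "v < n"
    and eq: "\<And>w. w \<in> {0, 1, 2} \<Longrightarrow> (cyc_dist n u w + 1) div 2 = (cyc_dist n v w + 1) div 2"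
  shows "u = v"
proof (cases "u < 2 \<or> v < 2")
  case True
  then have "u \<in> {0, 1} \<or> v \<in> {0, 1}" by auto
  then obtain w where w: "w \<in> {0, 1}" "u = w \<or> v = w" by blast
  have "(k + 1) div 2 = 0 \<longleftrightarrow> k = 0" for k :: nat by auto
  then have "cyc_dist n u w = 0 \<longleftrightarrow> cyc_dist n v w = 0"
    using eq[of w] w(1) by (metis insert_iff)
  moreover have "w < n" using w(1) assms(1) by auto
  ultimately show ?thesis using w(2) assms(3,4) by (auto simp: cyc_dist_eq_0_iff)
next
  case False
  define h where "h x w = (cyc_dist n x w + 1) div 2" for x w
  have eqs: "h u 0 = h v 0" "h u 1 = h v 1" "h u 2 = h v 2" using eq by (simp_all add: h_def)
  let ?cases = "\<lambda>x. h x 0 = h x 2 + 1 \<and> h x 0 + h x 1 = x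
      \<or> h x 2 = h x 0 + 1 \<and> h x 1 + h x 2 = n - x + 2
      \<or> h x 0 = h x 2 \<and> 2 * x = n + 2"
  have "?cases x" if "2 \<le> x" "x < n" for x
    by (rule half_cyc_dist_cases[OF assms(2) that]) (rule h_def)
  then have "?cases u" "?cases v" using False assms(3,4) by (simp_all only: not_less de_Morgan_disj)
  then show ?thesis
    unfolding eqs using assms(3,4) by (elim disjE conjE) linarith+
qed

lemma metric_dimension_square_cycle_le_3:
  assumes "n \<ge> 6" "n mod 4 \<noteq> 1"
  shows "metric_dimension (graph_square (cycle_graph n)) \<le> 3"
proof -
  have "resolving_set (graph_square (cycle_graph n)) {0, 1, 2}"
    unfolding resolving_set_def resolves_def pverts_square_cycle
  proof (intro conjI ballI impI, goal_cases)
    case (2 u v)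
    then obtain w where "w \<in> {0, 1, 2}" "(cyc_dist n u w + 1) div 2 \<noteq> (cyc_dist n v w + 1) div 2"
      using half_cyc_dist_determines[OF assms, of u v] by auto
    with 2 show ?case using assms
      by (intro bexI[of _ w]) (auto simp: graph_dist_square_cycle)
  qed (use assms in auto)
  then show ?thesis unfolding metric_dimension_def
    by (intro Least_le exI[of _ "{0, 1, 2}"]) (auto simp: card_insert_if)
qed

section \<open>All spanning supergraphs, and the conclusion\<close>

lemma metric_dimension_supergraph_square_cycle_ge_3:
  assumes "n \<ge> 6" "pair_graph H"
    and "spanning (with_proj (graph_square (cycle_graph n))) (with_proj H)"
  shows "metric_dimension H \<ge> 3"
proof -
  interpret pair_graph H by fact
  have verts: "pverts H = {..<n}" and arcs: "parcs (graph_square (cycle_graph n)) \<subseteq> parcs H"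
    using assms(3) by (auto simp: spanning_def subgraph_def pverts_square_cycle)
  show ?thesis
  proof (rule metric_dimension_ge_3)
    fix a assume "a \<in> pverts H"
    then obtain N where N: "card N = 4" "N \<subseteq> {x. (a, x) \<in> parcs H}"
      using degree_square_cycle_ge_4[of n a] assms(1) verts arcs by blast
    moreover have "finite {x. (a, x) \<in> parcs H}"
      by (rule finite_subset[of _ "pverts H"]) (auto dest: in_arcsD2)
    ultimately show "card {x. (a, x) \<in> parcs H} \<ge> 4" by (metis card_mono)
  qed (use verts assms(1) in \<open>simp add: lessThan_empty_iff\<close>)
qed

theorem mainTheorem4:
  fixes n :: nat
  assumes "n \<ge> 6" and "n mod 4 \<noteq> 1"
  shows "irreducible_graph (graph_square (cycle_graph n))
       \<and> threshold_dimension (graph_square (cycle_graph n)) = 3"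
proof -
  let ?G = "graph_square (cycle_graph n)"
  interpret C: pair_graph "cycle_graph n" using assms by (intro pair_graph_cycle_graph) auto
  interpret pair_graph ?G by (rule C.pair_graph_graph_square)
  have G: "pair_graph ?G" "spanning (with_proj ?G) (with_proj ?G)"
    by (unfold_locales, auto simp: spanning_def intro: subgraph_refl)
  \<comment> \<open>The square is a spanning supergraph of itself, so the lower bound for
    supergraphs also covers its own metric dimension, and the minimum 3 is attained there.\<close>
  have md: "metric_dimension ?G = 3"
    using metric_dimension_square_cycle_le_3[OF assms]
      metric_dimension_supergraph_square_cycle_ge_3[OF assms(1) G] by simp
  have "threshold_dimension ?G = 3"
    unfolding threshold_dimension_def
    by (rule Least_equality)
      (use md G metric_dimension_supergraph_square_cycle_ge_3[OF assms(1)] in blast)+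
  with md show ?thesis by (simp add: irreducible_graph_def)
qed

end
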